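(* Let $a<b$ be reals, $d\in\mathbb{N}^*$ and $0<\alpha\le1$. Let $L:\mathbb{R}^d\times\mathbb{R}^d\times[a,b]\to\mathbb{R}$, $(x,v,t)\mapsto L(x,v,t)$, be a Lagrangian (a map of class $\mathscr{C}^2$) which is $D^\alpha_-$-invariant under the action of a one parameter group of diffeomorphisms $\Phi=\{\phi(s,\cdot)\}_{s\in\mathbb{R}}$ of $\mathbb{R}^d$. Let $q$ be a solution of the fractional Euler-Lagrange equation $$\frac{\partial L}{\partial x}(q,D^\alpha_-q,t)+D^\alpha_+\left(\frac{\partial L}{\partial v}(q,D^\alpha_-q,t)\right)=0,$$ and let $$f=\frac{\partial\phi}{\partial s}(0,q)\qquad\text{and}\qquad g=\frac{\partial L}{\partial v}(q,D^\alpha_-q,t).$$ Suppose that $f,g\in\mathscr{C}^\infty([a,b],\mathbb{R}^d)$ and that the sequences of functions $\big(I^{p-\alpha}_-f\cdot g^{(p)}\big)_{p\in\mathbb{N}^*}$ and $\big(f^{(p)}\cdot I^{p-\alpha}_+g\big)_{p\in\mathbb{N}^*}$ converge uniformly to $0$ on $[a,b]$. Then the following equality holds on $(a,b)$: $$\frac{d}{dt}\left[\sum_{r=0}^{\infty}(-1)^r\,I^{r+1-\alpha}_-f\cdot g^{(r)}+f^{(r)}\cdot I^{r+1-\alpha}_+g\right]=0.$$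
   Context: $\mathbb{N}^*$ is the set of positive integers, $\cdot$ is the Euclidean scalar product on $\mathbb{R}^d$ (taken pointwise in $t$ for functions), and $f^{(r)}$ is the $r$-th classical derivative. Fractional operators. For $\beta>0$ the left and right Riemann-Liouville fractional integrals are $$I^\beta_-f(t)=\frac{1}{\Gamma(\beta)}\int_a^t(t-y)^{\beta-1}f(y)\,dy\ \ (t\in(a,b]),\qquad I^\beta_+f(t)=\frac{1}{\Gamma(\beta)}\int_t^b(y-t)^{\beta-1}f(y)\,dy\ \ (t\in[a,b)),$$ with $\Gamma$ Euler's Gamma function; for continuous $f$ they are extended by continuity with $I^\beta_-f(a)=0$ and $I^\beta_+f(b)=0$. For $\beta=0$, $I^0_\pm f=f$. For $0<\alpha\le1$, $D^\alpha_-f(t)=\frac{d}{dt}(I^{1-\alpha}_-f)(t)$ for $t\in(a,b]$ and $D^\alpha_+f(t)=-\frac{d}{dt}(I^{1-\alpha}_+f)(t)$ for $t\in[a,b)$, whenever the right-hand sides are defined. Solutions. A solution of the fractional Euler-Lagrange equation is a curve $q\in\mathscr{C}^2([a,b],\mathbb{R}^d)$ for which the equation is defined and satisfied at every $t\in(a,b)$. The function $g$ is a priori defined on $(a,b]$; the hypothesis $g\in\mathscr{C}^\infty([a,b],\mathbb{R}^d)$ means that it extends to a $\mathscr{C}^\infty$ function on $[a,b]$, still denoted $g$. One parameter group of diffeomorphisms. $\Phi=\{\phi(s,\cdot)\}_{s\in\mathbb{R}}$ is a family of diffeomorphisms $\phi(s,\cdot):\mathbb{R}^d\to\mathbb{R}^d$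 such that $\phi(0,\cdot)=\mathrm{Id}_{\mathbb{R}^d}$, $\phi(s,\cdot)\circ\phi(s',\cdot)=\phi(s+s',\cdot)$ for all $s,s'\in\mathbb{R}$, and $\phi$ is of class $\mathscr{C}^2$ on $\mathbb{R}\times\mathbb{R}^d$. Invariance. $L$ is $D^\alpha_-$-invariant under the action of $\Phi$ if for every solution $q$ of the fractional Euler-Lagrange equation displayed in the claim and every $s\in\mathbb{R}$, $$L\Big(\phi(s,q),D^\alpha_-\big(\phi(s,q)\big),t\Big)=L\big(q,D^\alpha_-q,t\big)$$ as functions of $t\in(a,b]$. In the bracket of the conclusion, both terms $(-1)^rI^{r+1-\alpha}_-f\cdot g^{(r)}$ and $f^{(r)}\cdot I^{r+1-\alpha}_+g$ are summed over $r$. *)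

theory Defs
  imports "HOL-Analysis.Analysis"
begin

text \<open>
  Classes C1 and C2 of maps on a set S. Derivatives are taken within S, so they are
  one-sided at the boundary of S. The definition is only used for sets on which such
  derivatives are unique: a whole space, \<open>{a..b}\<close>, and \<open>UNIV \<times> UNIV \<times> {a..b}\<close>.
\<close>

definition C1_on :: "'a::real_normed_vector set \<Rightarrow> ('a \<Rightarrow> 'b::real_normed_vector) \<Rightarrow> bool" where
  "C1_on S F \<longleftrightarrow> (\<exists>F' :: 'a \<Rightarrow> 'a \<Rightarrow>\<^sub>L 'b.
     (\<forall>x\<in>S. (F has_derivative blinfun_apply (F' x)) (at x within S)) \<and> continuous_on S F')"

definition C2_on :: "'a::real_normed_vector set \<Rightarrow> ('a \<Rightarrow> 'b::real_normed_vector) \<Rightarrow> bool" where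
  "C2_on S F \<longleftrightarrow> (\<exists>F' :: 'a \<Rightarrow> 'a \<Rightarrow>\<^sub>L 'b.
     (\<forall>x\<in>S. (F has_derivative blinfun_apply (F' x)) (at x within S)) \<and> C1_on S F')"

primrec nth_deriv :: "nat \<Rightarrow> real set \<Rightarrow> (real \<Rightarrow> 'b::real_normed_vector) \<Rightarrow> real \<Rightarrow> 'b" where
  "nth_deriv 0 S f = f"
| "nth_deriv (Suc n) S f = (\<lambda>t. vector_derivative (nth_deriv n S f) (at t within S))"

definition smooth_curve_on :: "real set \<Rightarrow> (real \<Rightarrow> 'b::real_normed_vector) \<Rightarrow> bool" where
  "smooth_curve_on S f \<longleftrightarrow> (\<forall>n. \<forall>t\<in>S. nth_deriv n S f differentiable (at t within S))"

definition gradient :: "('a::real_inner \<Rightarrow> real) \<Rightarrow> 'a \<Rightarrow> 'a" where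
  "gradient h x = (THE D. GDERIV h x :> D)"

text \<open>
  Riemann-Liouville fractional integrals of order \<open>\<beta> \<ge> 0\<close>. For \<open>\<beta> > 0\<close> the left integral is 0
  at a and the right integral is 0 at b, since the interval of integration is a single point;
  this is the extension by continuity for continuous f. The value \<open>0 powr (\<beta> - 1) = 0\<close> of the
  kernel at the end point \<open>y = t\<close> does not affect the integral.
\<close>

definition left_frac_integral ::
    "real \<Rightarrow> real \<Rightarrow> (real \<Rightarrow> 'b::euclidean_space) \<Rightarrow> real \<Rightarrow> 'b" where
  "left_frac_integral \<beta> a f t =
     (if \<beta> = 0 then f t
      else (1 / Gamma \<beta>) *\<^sub>R integral {a..t} (\<lambda>y. ((t - y) powr (\<beta> - 1)) *\<^sub>R f y))"

definition right_frac_integral ::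
    "real \<Rightarrow> real \<Rightarrow> (real \<Rightarrow> 'b::euclidean_space) \<Rightarrow> real \<Rightarrow> 'b" where
  "right_frac_integral \<beta> b f t =
     (if \<beta> = 0 then f t
      else (1 / Gamma \<beta>) *\<^sub>R integral {t..b} (\<lambda>y. ((y - t) powr (\<beta> - 1)) *\<^sub>R f y))"

definition left_frac_integral_exists ::
    "real \<Rightarrow> real \<Rightarrow> (real \<Rightarrow> 'b::euclidean_space) \<Rightarrow> real \<Rightarrow> bool" where
  "left_frac_integral_exists \<beta> a f t \<longleftrightarrow>
     \<beta> = 0 \<or> (\<lambda>y. ((t - y) powr (\<beta> - 1)) *\<^sub>R f y) integrable_on {a..t}"

definition right_frac_integral_exists ::
    "real \<Rightarrow> real \<Rightarrow> (real \<Rightarrow> 'b::euclidean_space) \<Rightarrow> real \<Rightarrow> bool" where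
  "right_frac_integral_exists \<beta> b f t \<longleftrightarrow>
     \<beta> = 0 \<or> (\<lambda>y. ((y - t) powr (\<beta> - 1)) *\<^sub>R f y) integrable_on {t..b}"

text \<open>
  Riemann-Liouville fractional derivatives of order \<open>0 < \<alpha> \<le> 1\<close>, at t in \<open>{a<..b}\<close> (left) and
  at t in \<open>{a..<b}\<close> (right). The right derivative at t only depends on f near t and on
  \<open>{t..b}\<close>; hence it makes sense for \<open>t > a\<close> when f is only given on \<open>{a<..b}\<close>.
\<close>

definition left_frac_deriv ::
    "real \<Rightarrow> real \<Rightarrow> real \<Rightarrow> (real \<Rightarrow> 'b::euclidean_space) \<Rightarrow> real \<Rightarrow> 'b" where
  "left_frac_deriv \<alpha> a b f t =
     vector_derivative (left_frac_integral (1 - \<alpha>) a f) (at t within {a<..b})"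

definition right_frac_deriv ::
    "real \<Rightarrow> real \<Rightarrow> real \<Rightarrow> (real \<Rightarrow> 'b::euclidean_space) \<Rightarrow> real \<Rightarrow> 'b" where
  "right_frac_deriv \<alpha> a b f t =
     - vector_derivative (right_frac_integral (1 - \<alpha>) b f) (at t within {a..<b})"

definition left_frac_deriv_exists ::
    "real \<Rightarrow> real \<Rightarrow> real \<Rightarrow> (real \<Rightarrow> 'b::euclidean_space) \<Rightarrow> real \<Rightarrow> bool" where
  "left_frac_deriv_exists \<alpha> a b f t \<longleftrightarrow>
     (\<forall>\<^sub>F x in nhds t. x \<in> {a<..b} \<longrightarrow> left_frac_integral_exists (1 - \<alpha>) a f x) \<and>
     left_frac_integral (1 - \<alpha>) a f differentiable (at t within {a<..b})"

definition right_frac_deriv_exists ::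
    "real \<Rightarrow> real \<Rightarrow> real \<Rightarrow> (real \<Rightarrow> 'b::euclidean_space) \<Rightarrow> real \<Rightarrow> bool" where
  "right_frac_deriv_exists \<alpha> a b f t \<longleftrightarrow>
     (\<forall>\<^sub>F x in nhds t. x \<in> {a..<b} \<longrightarrow> right_frac_integral_exists (1 - \<alpha>) b f x) \<and>
     right_frac_integral (1 - \<alpha>) b f differentiable (at t within {a..<b})"

text \<open>
  The partial gradients of \<open>L (x, v, t)\<close> in x and in v, along \<open>(q, D q, t)\<close>, where D is the
  left fractional derivative.
\<close>

definition dL_dx ::
    "real \<Rightarrow> real \<Rightarrow> real \<Rightarrow> ('b::euclidean_space \<times> 'b \<times> real \<Rightarrow> real) \<Rightarrow> (real \<Rightarrow> 'b) \<Rightarrow> real \<Rightarrow> 'b" where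
  "dL_dx \<alpha> a b L q t = gradient (\<lambda>x. L (x, left_frac_deriv \<alpha> a b q t, t)) (q t)"

definition dL_dv ::
    "real \<Rightarrow> real \<Rightarrow> real \<Rightarrow> ('b::euclidean_space \<times> 'b \<times> real \<Rightarrow> real) \<Rightarrow> (real \<Rightarrow> 'b) \<Rightarrow> real \<Rightarrow> 'b" where
  "dL_dv \<alpha> a b L q t = gradient (\<lambda>v. L (q t, v, t)) (left_frac_deriv \<alpha> a b q t)"

definition fractional_EL_solution ::
    "real \<Rightarrow> real \<Rightarrow> real \<Rightarrow> ('b::euclidean_space \<times> 'b \<times> real \<Rightarrow> real) \<Rightarrow> (real \<Rightarrow> 'b) \<Rightarrow> bool" where
  "fractional_EL_solution \<alpha> a b L q \<longleftrightarrow>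
     C2_on {a..b} q \<and>
     (\<forall>t\<in>{a<..b}. left_frac_deriv_exists \<alpha> a b q t) \<and>
     (\<forall>t\<in>{a<..<b}. right_frac_deriv_exists \<alpha> a b (dL_dv \<alpha> a b L q) t \<and>
        dL_dx \<alpha> a b L q t + right_frac_deriv \<alpha> a b (dL_dv \<alpha> a b L q) t = 0)"

definition diffeomorphism :: "('b::euclidean_space \<Rightarrow> 'b) \<Rightarrow> bool" where
  "diffeomorphism F \<longleftrightarrow> bij F \<and> C1_on UNIV F \<and> C1_on UNIV (inv F)"

definition one_parameter_group :: "(real \<Rightarrow> 'b::euclidean_space \<Rightarrow> 'b) \<Rightarrow> bool" where
  "one_parameter_group \<phi> \<longleftrightarrow>
     (\<forall>s. diffeomorphism (\<phi> s)) \<and>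
     \<phi> 0 = id \<and>
     (\<forall>s s'. \<phi> s \<circ> \<phi> s' = \<phi> (s + s')) \<and>
     C2_on UNIV (\<lambda>(s, x). \<phi> s x)"

definition frac_invariant ::
    "real \<Rightarrow> real \<Rightarrow> real \<Rightarrow> ('b::euclidean_space \<times> 'b \<times> real \<Rightarrow> real) \<Rightarrow>
     (real \<Rightarrow> 'b \<Rightarrow> 'b) \<Rightarrow> bool" where
  "frac_invariant \<alpha> a b L \<phi> \<longleftrightarrow>
     (\<forall>q s. fractional_EL_solution \<alpha> a b L q \<longrightarrow>
        (\<forall>t\<in>{a<..b}. L (\<phi> s (q t), left_frac_deriv \<alpha> a b (\<lambda>u. \<phi> s (q u)) t, t) =
                     L (q t, left_frac_deriv \<alpha> a b q t, t)))"

end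

theory Submission
  imports Defs
begin

text \<open>
  The bracket is differentiated term by term. Raising the order of a fractional integral by one
  integrates it, so the derivative of \<open>I\<^sub>-(r + 1 - \<alpha>) f \<bullet> g\<^sup>(\<^sup>r\<^sup>)\<close> is \<open>A r + A (r + 1)\<close>, and that of
  \<open>f\<^sup>(\<^sup>r\<^sup>) \<bullet> I\<^sub>+(r + 1 - \<alpha>) g\<close> is \<open>B (r + 1) - B r\<close>, where for \<open>r \<ge> 1\<close>
  \<open>A r = I\<^sub>-(r - \<alpha>) f \<bullet> g\<^sup>(\<^sup>r\<^sup>)\<close> and \<open>B r = f\<^sup>(\<^sup>r\<^sup>) \<bullet> I\<^sub>+(r - \<alpha>) g\<close>, while \<open>A 0 = D\<^sub>- f \<bullet> g\<close> and
  \<open>B 0 = f \<bullet> D\<^sub>+ g\<close> with the fractional derivatives of order \<alpha>. With the alternating sign both sums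
  telescope, and the derivatives of the partial sums tend uniformly to \<open>A 0 - B 0\<close> because \<open>A r\<close>
  and \<open>B r\<close> tend uniformly to 0. Convergence of the series itself costs nothing more: for \<open>r \<ge> 1\<close>
  the left terms vanish at \<open>a\<close> and the right terms vanish at \<open>b\<close>, so each of the two series
  converges at one point (\<open>telescoping_series_has_derivative\<close>). This yields \<open>transfer_formula\<close>,
  valid for any pair of smooth curves with these two uniform limits.
  
  That \<open>A 0 = B 0\<close> is Noether's argument (\<open>fractional_noether_identity\<close>). Differentiating
  the invariance of \<open>L\<close> in \<open>s\<close> at \<open>s = 0\<close> gives
  \<open>\<partial>\<^sub>x L \<bullet> f + \<partial>\<^sub>v L \<bullet> D\<^sub>- f = 0\<close>, and \<open>\<partial>\<^sub>x L = - D\<^sub>+ (\<partial>\<^sub>v L)\<close> along a solution. The analytic point is that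
  \<open>D\<^sub>-\<close> commutes with the \<open>s\<close>-derivative, although its kernel is singular. One integration by parts
  writes \<open>D\<^sub>- h (t)\<close> as a multiple of \<open>h (a)\<close> plus the fractional integral of \<open>h'\<close>, so \<open>D\<^sub>- h (t)\<close> is
  continuous for uniform convergence of \<open>h'\<close>; and since the flow is of class C2, the
  difference quotients in \<open>s\<close> of the velocities of \<open>\<phi> s \<circ> q\<close> do converge uniformly
  (\<open>left_frac_deriv_variation\<close>).
\<close>

section \<open>The truncated power kernel and the Gamma function\<close>

text \<open>
  Cutting the kernel \<open>(t - y)\<close> powr \<gamma> off to 0 for \<open>y > t\<close> makes the domain of integration
  independent of \<open>t\<close>. For \<open>\<gamma> > 1\<close> the cut-off kernel is still of class C1, so one may then
  differentiate under the integral sign.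
\<close>

lemma has_real_derivative_pos_part_powr:
  fixes x \<gamma> :: real
  assumes "1 < \<gamma>"
  shows "((\<lambda>x. max 0 x powr \<gamma>) has_real_derivative \<gamma> * max 0 x powr (\<gamma> - 1)) (at x)"
proof -
  consider "x > 0" | "x < 0" | "x = 0" by linarith
  then show ?thesis
  proof cases
    case 1
    have "((\<lambda>x. x powr \<gamma>) has_real_derivative \<gamma> * max 0 x powr (\<gamma> - 1)) (at x)"
      using 1 has_real_derivative_powr[of x \<gamma>] by simp
    then show ?thesis
      by (rule has_field_derivative_transform_within_open[where S = "{0<..}"]) (use 1 in auto)
  next
    case 2
    have "((\<lambda>x::real. 0::real) has_real_derivative \<gamma> * max 0 x powr (\<gamma> - 1)) (at x)"
      using 2 by simp
    then show ?thesis
      by (rule has_field_derivative_transform_within_open[where S = "{..<0}"]) (use 2 in auto)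
  next
    case 3
    have "((\<lambda>h. max 0 h powr \<gamma> / h) \<longlongrightarrow> 0) (at 0)"
    proof (rule Lim_null_comparison)
      have "((\<lambda>h::real. max 0 h powr (\<gamma> - 1)) \<longlongrightarrow> (max 0 0) powr (\<gamma> - 1)) (at 0)"
        by (rule tendsto_powr' tendsto_intros)+ (use assms in auto)
      then show "((\<lambda>h::real. max 0 h powr (\<gamma> - 1)) \<longlongrightarrow> 0) (at 0)" by simp
      show "\<forall>\<^sub>F h in at 0. norm (max 0 h powr \<gamma> / h) \<le> max 0 h powr (\<gamma> - 1)"
        by (rule always_eventually) (auto simp: max_def powr_diff)
    qed
    then show ?thesis using 3 by (simp add: DERIV_def)
  qed
qed

lemma has_vector_derivative_scaleR_const:
  assumes "(h has_real_derivative D) (at x within S)"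
  shows "((\<lambda>x. h x *\<^sub>R c) has_vector_derivative D *\<^sub>R c) (at x within S)"
  using has_vector_derivative_scaleR[OF assms has_vector_derivative_const[of c]] by simp

lemma Gamma_plus1_pos:
  fixes \<beta> :: real
  assumes "0 < \<beta>"
  shows "Gamma (\<beta> + 1) = \<beta> * Gamma \<beta>"
  using assms by (intro Gamma_plus1) (auto dest: nonpos_Ints_nonpos)

lemma Gamma_nonzero_pos:
  fixes \<beta> :: real
  assumes "0 < \<beta>"
  shows "Gamma \<beta> \<noteq> 0"
  using Gamma_real_pos[OF assms] by simp

lemma continuous_on_pos_part_powr_scaleR:
  fixes f :: "real \<Rightarrow> 'b::euclidean_space"
  assumes "0 < \<gamma>" "continuous_on S f"
  shows "continuous_on S (\<lambda>y. max 0 (t - y) powr \<gamma> *\<^sub>R f y)"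
  by (intro continuous_intros continuous_on_powr' assms) (use assms in auto)

lemma left_frac_integral_eq_pos_part:
  fixes f :: "real \<Rightarrow> 'b::euclidean_space"
  assumes "0 < \<gamma>" "t \<in> {a..b}" "continuous_on {a..b} f"
  shows "left_frac_integral (\<gamma> + 1) a f t =
    (1 / Gamma (\<gamma> + 1)) *\<^sub>R integral {a..b} (\<lambda>y. max 0 (t - y) powr \<gamma> *\<^sub>R f y)"
proof -
  let ?k = "\<lambda>y. max 0 (t - y) powr \<gamma> *\<^sub>R f y"
  have int: "?k integrable_on {a..b}"
    by (intro integrable_continuous_real continuous_on_pos_part_powr_scaleR assms)
  have "integral {a..t} ?k + integral {t..b} ?k = integral {a..b} ?k"
    using assms int by (intro Henstock_Kurzweil_Integration.integral_combine) auto
  moreover have "integral {t..b} ?k = integral {t..b} (\<lambda>y. 0)"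
    by (intro integral_cong) auto
  moreover have "integral {a..t} ?k = integral {a..t} (\<lambda>y. (t - y) powr \<gamma> *\<^sub>R f y)"
    by (intro integral_cong) auto
  ultimately show ?thesis using assms by (simp add: left_frac_integral_def)
qed

section \<open>Differentiating fractional integrals\<close>

lemma left_frac_integral_deriv_regular_kernel:
  fixes f :: "real \<Rightarrow> 'b::euclidean_space"
  assumes \<gamma>: "1 < \<gamma>" and t: "t \<in> {a..b}" and f: "continuous_on {a..b} f"
  shows "(left_frac_integral (\<gamma> + 1) a f has_vector_derivative left_frac_integral \<gamma> a f t)
           (at t within {a..b})"
proof -
  let ?K = "\<lambda>t. integral (cbox a b) (\<lambda>y. max 0 (t - y) powr \<gamma> *\<^sub>R f y)"
  let ?K' = "\<lambda>t y. (\<gamma> * max 0 (t - y) powr (\<gamma> - 1)) *\<^sub>R f y"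
  have "(?K has_vector_derivative integral (cbox a b) (?K' t)) (at t within {a..b})"
  proof (rule leibniz_rule_vector_derivative)
    fix x y assume "x \<in> {a..b}" "y \<in> cbox a b"
    have "((\<lambda>x. max 0 (x - y) powr \<gamma>) has_real_derivative \<gamma> * max 0 (x - y) powr (\<gamma> - 1)) (at x)"
      using DERIV_shift[of "\<lambda>x. max 0 x powr \<gamma>" _ x "- y"]
        has_real_derivative_pos_part_powr[OF \<gamma>, of "x - y"] by simp
    then show "((\<lambda>x. max 0 (x - y) powr \<gamma> *\<^sub>R f y) has_vector_derivative ?K' x y) (at x within {a..b})"
      by (rule has_vector_derivative_scaleR_const[OF has_field_derivative_at_within])
  next
    fix x assume "x \<in> {a..b}"
    show "(\<lambda>y. max 0 (x - y) powr \<gamma> *\<^sub>R f y) integrable_on cbox a b"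
      unfolding cbox_interval
      by (intro integrable_continuous_real continuous_on_pos_part_powr_scaleR f) (use \<gamma> in auto)
  next
    have "continuous_on ({a..b} \<times> {a..b}) (\<lambda>z. f (snd z))"
      by (rule continuous_on_compose2[OF f]) (auto intro: continuous_intros)
    then show "continuous_on ({a..b} \<times> cbox a b) (\<lambda>(x, y). ?K' x y)"
      unfolding case_prod_unfold
      by (intro continuous_intros continuous_on_powr') (use \<gamma> in auto)
  qed (use t in auto)
  then have D: "((\<lambda>t. (1 / Gamma (\<gamma> + 1)) *\<^sub>R ?K t) has_vector_derivative
      (1 / Gamma (\<gamma> + 1)) *\<^sub>R integral (cbox a b) (?K' t)) (at t within {a..b})"
    by (rule bounded_linear.has_vector_derivative[OF bounded_linear_scaleR_right])
  have "(1 / Gamma (\<gamma> + 1)) *\<^sub>R integral (cbox a b) (?K' t) = left_frac_integral \<gamma> a f t"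
  proof -
    have "?K' t = (\<lambda>y. \<gamma> *\<^sub>R (max 0 (t - y) powr (\<gamma> - 1) *\<^sub>R f y))" by auto
    from arg_cong[OF this, of "integral (cbox a b)"] have "integral (cbox a b) (?K' t) =
        \<gamma> *\<^sub>R integral {a..b} (\<lambda>y. max 0 (t - y) powr (\<gamma> - 1) *\<^sub>R f y)"
      by (simp only: integral_cmul cbox_interval)
    moreover have "Gamma (\<gamma> + 1) = \<gamma> * Gamma \<gamma>"
      using \<gamma> by (intro Gamma_plus1_pos) simp
    ultimately show ?thesis
      using left_frac_integral_eq_pos_part[of "\<gamma> - 1" t a b f] \<gamma> t f
      by simp
  qed
  moreover have "left_frac_integral (\<gamma> + 1) a f x = (1 / Gamma (\<gamma> + 1)) *\<^sub>R ?K x"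
    if "x \<in> {a..b}" for x
    using left_frac_integral_eq_pos_part[OF _ that f, of \<gamma>] \<gamma> by simp
  ultimately show ?thesis
    using has_vector_derivative_transform[OF t _ D] by metis
qed

text \<open>
  Integration by parts trades one derivative of \<open>f\<close> for one order of integration. It is the
  device that reduces a singular kernel (\<open>0 < \<beta> < 1\<close>) to a regular one.
\<close>

lemma left_frac_integral_by_parts:
  fixes f f' :: "real \<Rightarrow> 'b::euclidean_space"
  assumes \<beta>: "0 < \<beta>" and t: "t \<in> {a..b}"
    and f: "\<And>u. u \<in> {a..b} \<Longrightarrow> (f has_vector_derivative f' u) (at u within {a..b})"
    and f': "continuous_on {a..b} f'"
  shows left_frac_kernel_integrable: "(\<lambda>y. (t - y) powr (\<beta> - 1) *\<^sub>R f y) integrable_on {a..t}"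
    and "left_frac_integral \<beta> a f t =
      ((t - a) powr \<beta> / Gamma (\<beta> + 1)) *\<^sub>R f a + left_frac_integral (\<beta> + 1) a f' t"
proof -
  let ?J = "integral {a..t} (\<lambda>y. (t - y) powr \<beta> *\<^sub>R f' y)"
  have sub: "{a..t} \<subseteq> {a..b}" using t by auto
  have cf: "continuous_on {a..t} f"
    using f sub by (meson continuous_on_subset continuous_on_vector_derivative)
  have cont: "continuous_on {a..t} (\<lambda>y. (t - y) powr \<beta> *\<^sub>R h y)"
    if "continuous_on {a..t} h" for h :: "real \<Rightarrow> 'b"
    using that by (intro continuous_intros continuous_on_powr') (use \<beta> in auto)
  have "((\<lambda>y. (t - y) powr \<beta> *\<^sub>R f' y + (- \<beta> * (t - y) powr (\<beta> - 1)) *\<^sub>R f y) has_integral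
      (t - t) powr \<beta> *\<^sub>R f t - (t - a) powr \<beta> *\<^sub>R f a) {a..t}"
  proof (rule fundamental_theorem_of_calculus_interior)
    show "continuous_on {a..t} (\<lambda>y. (t - y) powr \<beta> *\<^sub>R f y)" by (rule cont[OF cf])
    fix y assume y: "y \<in> {a<..<t}"
    have "(f has_vector_derivative f' y) (at y within {a..b})" using f y t by auto
    then have "(f has_vector_derivative f' y) (at y)"
      using y t by (simp add: at_within_Icc_at)
    moreover have "((\<lambda>y. (t - y) powr \<beta>) has_real_derivative - \<beta> * (t - y) powr (\<beta> - 1)) (at y)"
      using y by (auto intro!: derivative_eq_intros)
    ultimately show "((\<lambda>y. (t - y) powr \<beta> *\<^sub>R f y) has_vector_derivative
        (t - y) powr \<beta> *\<^sub>R f' y + (- \<beta> * (t - y) powr (\<beta> - 1)) *\<^sub>R f y) (at y)"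
      by (intro has_vector_derivative_scaleR)
  qed (use t in auto)
  moreover have "((\<lambda>y. (t - y) powr \<beta> *\<^sub>R f' y) has_integral ?J) {a..t}"
    using cont[OF continuous_on_subset[OF f' sub]]
    by (intro integrable_integral integrable_continuous_real)
  ultimately have "((\<lambda>y. (- \<beta> * (t - y) powr (\<beta> - 1)) *\<^sub>R f y) has_integral
      - ((t - a) powr \<beta> *\<^sub>R f a) - ?J) {a..t}"
    using has_integral_diff[of "\<lambda>y. (t - y) powr \<beta> *\<^sub>R f' y + (- \<beta> * (t - y) powr (\<beta> - 1)) *\<^sub>R f y"
        _ _ "\<lambda>y. (t - y) powr \<beta> *\<^sub>R f' y"] by fastforce
  then have "((\<lambda>y. (- 1 / \<beta>) *\<^sub>R ((- \<beta> * (t - y) powr (\<beta> - 1)) *\<^sub>R f y)) has_integral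
      (- 1 / \<beta>) *\<^sub>R (- ((t - a) powr \<beta> *\<^sub>R f a) - ?J)) {a..t}"
    by (rule has_integral_cmul)
  then have I: "((\<lambda>y. (t - y) powr (\<beta> - 1) *\<^sub>R f y) has_integral
      (1 / \<beta>) *\<^sub>R ((t - a) powr \<beta> *\<^sub>R f a + ?J)) {a..t}"
    using \<beta> by (simp add: scaleR_right_diff_distrib scaleR_right_distrib)
  then show "(\<lambda>y. (t - y) powr (\<beta> - 1) *\<^sub>R f y) integrable_on {a..t}" by blast
  have "Gamma (\<beta> + 1) = \<beta> * Gamma \<beta>"
    by (rule Gamma_plus1_pos[OF \<beta>])
  then show "left_frac_integral \<beta> a f t =
      ((t - a) powr \<beta> / Gamma (\<beta> + 1)) *\<^sub>R f a + left_frac_integral (\<beta> + 1) a f' t"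
    using integral_unique[OF I] \<beta>
    by (simp add: left_frac_integral_def scaleR_right_distrib field_simps)
qed

text \<open>
  After one integration by parts the kernel has exponent \<open>\<beta> + 1 > 1\<close>, so the regular case applies;
  integrating back by parts identifies the result. The case \<open>\<beta> = 0\<close> is the fundamental theorem
  of calculus.
\<close>

lemma left_frac_integral_has_vector_derivative:
  fixes f f' :: "real \<Rightarrow> 'b::euclidean_space"
  assumes \<beta>: "0 \<le> \<beta>" and t: "t \<in> {a..b}"
    and f: "\<And>u. u \<in> {a..b} \<Longrightarrow> (f has_vector_derivative f' u) (at u within {a..b})"
    and f': "continuous_on {a..b} f'"
  shows "(left_frac_integral (\<beta> + 1) a f has_vector_derivative left_frac_integral \<beta> a f t)
           (at t within {a..b})"
proof (cases "\<beta> = 0")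
  case True
  have "continuous_on {a..b} f" using f continuous_on_vector_derivative by blast
  then have "((\<lambda>x. integral {a..x} f) has_vector_derivative f t) (at t within {a..b})"
    using t by (rule integral_has_vector_derivative)
  moreover have "left_frac_integral 1 a f = (\<lambda>x. integral {a..x} f)"
  proof
    fix x
    have "integral {a..x} (\<lambda>y. (x - y) powr 0 *\<^sub>R f y) = integral {a..x} f"
      by (rule integral_spike[of "{x}"]) auto
    then show "left_frac_integral 1 a f x = integral {a..x} f" by (simp add: left_frac_integral_def)
  qed
  ultimately show ?thesis
    using True by (simp add: left_frac_integral_def[of 0])
next
  case False
  then have \<beta>: "0 < \<beta>" using \<beta> by simp
  have G: "Gamma (\<beta> + 1 + 1) = (\<beta> + 1) * Gamma (\<beta> + 1)" "Gamma (\<beta> + 1) \<noteq> 0"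
    using \<beta> by (intro Gamma_plus1_pos Gamma_nonzero_pos; simp)+
  let ?P = "\<lambda>t. (max 0 (t - a) powr (\<beta> + 1) / Gamma (\<beta> + 1 + 1)) *\<^sub>R f a"
  have "((\<lambda>x. max 0 (x - a) powr (\<beta> + 1)) has_real_derivative
      (\<beta> + 1) * max 0 (t - a) powr \<beta>) (at t)"
    using DERIV_shift[of "\<lambda>x. max 0 x powr (\<beta> + 1)" _ t "- a"]
      has_real_derivative_pos_part_powr[of "\<beta> + 1" "t - a"] \<beta>
    by simp
  from has_field_derivative_at_within[OF this] have "(?P has_vector_derivative
      ((\<beta> + 1) * max 0 (t - a) powr \<beta> / Gamma (\<beta> + 1 + 1)) *\<^sub>R f a) (at t within {a..b})"
    by (intro has_vector_derivative_scaleR_const DERIV_cdivide)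
  moreover have "(\<beta> + 1) * max 0 (t - a) powr \<beta> / Gamma (\<beta> + 1 + 1) =
      (t - a) powr \<beta> / Gamma (\<beta> + 1)"
    using G t \<beta> by simp
  ultimately have D: "((\<lambda>t. ?P t + left_frac_integral (\<beta> + 1 + 1) a f' t) has_vector_derivative
      ((t - a) powr \<beta> / Gamma (\<beta> + 1)) *\<^sub>R f a + left_frac_integral (\<beta> + 1) a f' t)
        (at t within {a..b})"
    using left_frac_integral_deriv_regular_kernel[of "\<beta> + 1" t a b f'] \<beta> t f'
    by (intro has_vector_derivative_add) auto
  have "left_frac_integral \<beta> a f t = ((t - a) powr \<beta> / Gamma (\<beta> + 1)) *\<^sub>R f a +
      left_frac_integral (\<beta> + 1) a f' t"
    using left_frac_integral_by_parts(2)[OF \<beta> t f f'] .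
  moreover have "left_frac_integral (\<beta> + 1) a f x = ?P x + left_frac_integral (\<beta> + 1 + 1) a f' x"
    if "x \<in> {a..b}" for x
    using left_frac_integral_by_parts(2)[of "\<beta> + 1" x a b f f'] \<beta> that f f' by auto
  ultimately show ?thesis
    using has_vector_derivative_transform[OF t _ D] by metis
qed

text \<open>
  Without a spare order of integration the boundary term of the integration by parts has a
  derivative that may blow up at \<open>a\<close>, which is why \<open>t\<close> is interior here. For \<open>\<beta> = 0\<close> the coefficient of
  \<open>f a\<close> is 0, because division by the pole \<open>Gamma 0\<close> yields 0.
\<close>

lemma left_frac_integral_has_vector_derivative_interior:
  fixes f f' f'' :: "real \<Rightarrow> 'b::euclidean_space"
  assumes \<beta>: "0 \<le> \<beta>" and t: "t \<in> {a<..<b}"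
    and f: "\<And>u. u \<in> {a..b} \<Longrightarrow> (f has_vector_derivative f' u) (at u within {a..b})"
    and f': "\<And>u. u \<in> {a..b} \<Longrightarrow> (f' has_vector_derivative f'' u) (at u within {a..b})"
    and f'': "continuous_on {a..b} f''"
  shows "(left_frac_integral \<beta> a f has_vector_derivative
           ((t - a) powr (\<beta> - 1) / Gamma \<beta>) *\<^sub>R f a + left_frac_integral \<beta> a f' t) (at t)"
proof (cases "\<beta> = 0")
  case True
  then show ?thesis
    using f[of t] t at_within_Icc_at[of a t b] Gamma_eq_zero_iff[of "0::real"]
    by (simp add: left_frac_integral_def[abs_def])
next
  case False
  then have \<beta>: "0 < \<beta>" using \<beta> by simp
  have tI: "t \<in> {a..b}" and at: "at t within {a..b} = at t"
    using t by (auto intro: at_within_Icc_at)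
  have G: "Gamma (\<beta> + 1) = \<beta> * Gamma \<beta>" "Gamma \<beta> \<noteq> 0"
    using \<beta> by (intro Gamma_plus1_pos Gamma_nonzero_pos; simp)+
  have cf': "continuous_on {a..b} f'" using f' continuous_on_vector_derivative by blast
  have "((\<lambda>x. (x - a) powr \<beta> / Gamma (\<beta> + 1)) has_real_derivative
      (t - a) powr (\<beta> - 1) / Gamma \<beta>) (at t)"
    using t G \<beta> by (auto intro!: derivative_eq_intros simp: field_simps)
  then have "((\<lambda>x. ((x - a) powr \<beta> / Gamma (\<beta> + 1)) *\<^sub>R f a) has_vector_derivative
      ((t - a) powr (\<beta> - 1) / Gamma \<beta>) *\<^sub>R f a) (at t)"
    by (rule has_vector_derivative_scaleR_const)
  moreover have "(left_frac_integral (\<beta> + 1) a f' has_vector_derivative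
      left_frac_integral \<beta> a f' t) (at t)"
    using left_frac_integral_has_vector_derivative[OF _ tI f' f'', of \<beta>] \<beta> at by simp
  ultimately have D: "((\<lambda>x. ((x - a) powr \<beta> / Gamma (\<beta> + 1)) *\<^sub>R f a +
      left_frac_integral (\<beta> + 1) a f' x) has_vector_derivative
      ((t - a) powr (\<beta> - 1) / Gamma \<beta>) *\<^sub>R f a + left_frac_integral \<beta> a f' t) (at t)"
    by (rule has_vector_derivative_add)
  show ?thesis
    by (rule has_vector_derivative_transform_within_open[OF D, of "{a<..<b}"])
      (use t left_frac_integral_by_parts(2)[OF \<beta> _ f cf'] in auto)
qed

text \<open>
  Reflection at the origin turns statements on left integrals into statements on right integrals.
\<close>

lemma right_frac_integral_reflect:
  "right_frac_integral \<beta> b g t = left_frac_integral \<beta> (- b) (\<lambda>y. g (- y)) (- t)"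
proof -
  have "- t - y = - y - t" for y by simp
  then show ?thesis
    using Henstock_Kurzweil_Integration.integral_reflect_real[of b t
        "\<lambda>y. (y - t) powr (\<beta> - 1) *\<^sub>R g y"]
    by (simp only: right_frac_integral_def left_frac_integral_def) simp
qed

lemma has_vector_derivative_reflect:
  assumes "(f has_vector_derivative D) (at (- t) within uminus ` S)"
  shows "((\<lambda>x. f (- x)) has_vector_derivative - D) (at t within S)"
  using vector_diff_chain_within[OF has_vector_derivative_minus[OF has_vector_derivative_id] assms]
  by (simp add: comp_def)

lemma right_frac_integral_has_vector_derivative:
  fixes g g' :: "real \<Rightarrow> 'b::euclidean_space"
  assumes \<beta>: "0 \<le> \<beta>" and t: "t \<in> {a..b}"
    and g: "\<And>u. u \<in> {a..b} \<Longrightarrow> (g has_vector_derivative g' u) (at u within {a..b})"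
    and g': "continuous_on {a..b} g'"
  shows "(right_frac_integral (\<beta> + 1) b g has_vector_derivative - right_frac_integral \<beta> b g t)
           (at t within {a..b})"
proof -
  have "((\<lambda>y. g (- y)) has_vector_derivative - g' (- u)) (at u within {-b..-a})"
    if "u \<in> {-b..-a}" for u
    using that g[of "- u"] by (intro has_vector_derivative_reflect) auto
  moreover have "continuous_on {-b..-a} (\<lambda>u. - g' (- u))"
    by (intro continuous_on_minus continuous_on_compose2[OF g']) (auto intro: continuous_intros)
  ultimately have "(left_frac_integral (\<beta> + 1) (-b) (\<lambda>y. g (- y)) has_vector_derivative
      left_frac_integral \<beta> (-b) (\<lambda>y. g (- y)) (- t)) (at (- t) within {-b..-a})"
    using t by (intro left_frac_integral_has_vector_derivative[OF \<beta>]) auto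
  then have "((\<lambda>x. left_frac_integral (\<beta> + 1) (-b) (\<lambda>y. g (- y)) (- x)) has_vector_derivative
      - left_frac_integral \<beta> (-b) (\<lambda>y. g (- y)) (- t)) (at t within {a..b})"
    by (intro has_vector_derivative_reflect) simp
  then show ?thesis
    unfolding right_frac_integral_reflect[symmetric] .
qed

text \<open>
  This is the decomposition of the Riemann-Liouville derivative into a boundary term and the
  Caputo derivative.
\<close>

lemma left_frac_deriv_eq:
  fixes f f' f'' :: "real \<Rightarrow> 'b::euclidean_space"
  assumes \<alpha>: "\<alpha> \<le> 1" and t: "t \<in> {a<..<b}"
    and f: "\<And>u. u \<in> {a..b} \<Longrightarrow> (f has_vector_derivative f' u) (at u within {a..b})"
    and f': "\<And>u. u \<in> {a..b} \<Longrightarrow> (f' has_vector_derivative f'' u) (at u within {a..b})"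
    and f'': "continuous_on {a..b} f''"
  shows "(left_frac_integral (1 - \<alpha>) a f has_vector_derivative left_frac_deriv \<alpha> a b f t) (at t)"
    and "left_frac_deriv \<alpha> a b f t =
      ((t - a) powr (- \<alpha>) / Gamma (1 - \<alpha>)) *\<^sub>R f a + left_frac_integral (1 - \<alpha>) a f' t"
proof -
  have D: "(left_frac_integral (1 - \<alpha>) a f has_vector_derivative
      ((t - a) powr (- \<alpha>) / Gamma (1 - \<alpha>)) *\<^sub>R f a + left_frac_integral (1 - \<alpha>) a f' t) (at t)"
    using left_frac_integral_has_vector_derivative_interior[OF _ t f f' f'', of "1 - \<alpha>"] \<alpha> by simp
  have "at t within {a<..b} = at t"
    by (rule at_within_nhd[of t "{a<..<b}"]) (use t in auto)
  with vector_derivative_at[OF D] show eq: "left_frac_deriv \<alpha> a b f t =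
      ((t - a) powr (- \<alpha>) / Gamma (1 - \<alpha>)) *\<^sub>R f a + left_frac_integral (1 - \<alpha>) a f' t"
    by (simp add: left_frac_deriv_def)
  show "(left_frac_integral (1 - \<alpha>) a f has_vector_derivative left_frac_deriv \<alpha> a b f t) (at t)"
    using D by (simp only: eq)
qed

section \<open>Smooth curves and telescoping series\<close>

lemma smooth_curve_on_has_vector_derivative:
  assumes "smooth_curve_on S f" "t \<in> S"
  shows "(nth_deriv n S f has_vector_derivative nth_deriv (Suc n) S f t) (at t within S)"
  using assms by (simp add: smooth_curve_on_def vector_derivative_works[symmetric])

lemma smooth_curve_on_continuous:
  assumes "smooth_curve_on S f"
  shows "continuous_on S (nth_deriv n S f)"
  using smooth_curve_on_has_vector_derivative[OF assms] continuous_on_vector_derivative by blast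

lemma smooth_curve_on_derivs:
  assumes "smooth_curve_on S f" "t \<in> S"
  shows "(f has_vector_derivative nth_deriv 1 S f t) (at t within S)"
    and "(nth_deriv 1 S f has_vector_derivative nth_deriv 2 S f t) (at t within S)"
  using smooth_curve_on_has_vector_derivative[OF assms, of 0]
    smooth_curve_on_has_vector_derivative[OF assms, of 1]
  by (simp_all add: numeral_2_eq_2)

text \<open>
  The derivatives of the partial sums are \<open>E n - E 0\<close>, which converge uniformly, and all partial
  sums agree at \<open>x0\<close>; this is what the theorem on term-by-term differentiation asks for.
\<close>

lemma telescoping_series_has_derivative:
  fixes c E :: "nat \<Rightarrow> real \<Rightarrow> real"
  assumes c: "\<And>r t. t \<in> {a..b} \<Longrightarrow>
      (c r has_real_derivative E (Suc r) t - E r t) (at t within {a..b})"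
    and E: "uniform_limit {a..b} E (\<lambda>_. 0) sequentially"
    and x0: "x0 \<in> {a..b}" "\<And>r. c r x0 = 0"
    and t: "t \<in> {a..b}"
  shows "summable (\<lambda>r. c r t)"
    and "((\<lambda>t. \<Sum>r. c r t) has_real_derivative - E 0 t) (at t within {a..b})"
proof -
  have "uniform_limit {a..b} (\<lambda>n x. E n x - E 0 x) (\<lambda>x. 0 - E 0 x) sequentially"
    by (intro uniform_limit_intros E)
  then have "uniform_limit {a..b} (\<lambda>n x. \<Sum>i<n. E (Suc i) x - E i x) (\<lambda>x. - E 0 x) sequentially"
    by (simp add: sum_lessThan_telescope[of "\<lambda>i. E i x" for x])
  then have "\<exists>g. \<forall>x\<in>{a..b}. (\<lambda>n. c n x) sums g x \<and>
      (g has_field_derivative - E 0 x) (at x within {a..b})"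
    by (intro has_field_derivative_series[OF _ c _ x0(1)]) (auto simp: x0(2))
  then obtain g where g: "\<And>x. x \<in> {a..b} \<Longrightarrow> (\<lambda>n. c n x) sums g x"
      "\<And>x. x \<in> {a..b} \<Longrightarrow> (g has_real_derivative - E 0 x) (at x within {a..b})"
    by blast
  show "summable (\<lambda>r. c r t)" using g(1)[OF t] by (rule sums_summable)
  show "((\<lambda>t. \<Sum>r. c r t) has_real_derivative - E 0 t) (at t within {a..b})"
    unfolding has_real_derivative_iff_has_vector_derivative
    by (rule has_vector_derivative_transform[OF t _
          g(2)[OF t, unfolded has_real_derivative_iff_has_vector_derivative]])
      (use g(1) sums_unique in metis)
qed

text \<open>
  Fractional integration by parts in differential form. The number \<open>Dg\<close> is the right fractional
  derivative of \<open>g\<close> at \<open>t\<close>. It is a parameter because in Noether's argument this derivative is that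
  of \<open>\<partial>\<^sub>v L\<close> along the solution, a function that agrees with \<open>g\<close> only away from \<open>a\<close>.
\<close>

lemma transfer_formula:
  fixes f g :: "real \<Rightarrow> 'b::euclidean_space"
  assumes \<alpha>: "\<alpha> \<le> 1" and t: "t \<in> {a<..<b}"
    and f: "smooth_curve_on {a..b} f" and g: "smooth_curve_on {a..b} g"
    and A0: "uniform_limit {a..b}
      (\<lambda>p t. left_frac_integral (real (Suc p) - \<alpha>) a f t \<bullet> nth_deriv (Suc p) {a..b} g t)
      (\<lambda>_. 0) sequentially"
    and B0: "uniform_limit {a..b}
      (\<lambda>p t. nth_deriv (Suc p) {a..b} f t \<bullet> right_frac_integral (real (Suc p) - \<alpha>) b g t)
      (\<lambda>_. 0) sequentially"
    and Dg: "(right_frac_integral (1 - \<alpha>) b g has_vector_derivative - Dg) (at t)"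
  defines "u \<equiv> \<lambda>r t.
      (- 1) ^ r * (left_frac_integral (real r + 1 - \<alpha>) a f t \<bullet> nth_deriv r {a..b} g t)"
    and "w \<equiv> \<lambda>r t. nth_deriv r {a..b} f t \<bullet> right_frac_integral (real r + 1 - \<alpha>) b g t"
  shows "summable (\<lambda>r. u r t + w r t)"
    and "((\<lambda>t. \<Sum>r. u r t + w r t) has_real_derivative
           left_frac_deriv \<alpha> a b f t \<bullet> g t - f t \<bullet> Dg) (at t)"
proof -
  have tI: "t \<in> {a..b}" and at: "at t within {a..b} = at t"
    using t by (auto intro: at_within_Icc_at)
  note inner = bounded_bilinear.has_vector_derivative[OF bounded_bilinear_inner]
  define A where "A p t = left_frac_integral (real p - \<alpha>) a f t \<bullet> nth_deriv p {a..b} g t" for p t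
  define B where "B p t = nth_deriv p {a..b} f t \<bullet> right_frac_integral (real p - \<alpha>) b g t" for p t
  have A0: "uniform_limit {a..b} (\<lambda>r. A (Suc r)) (\<lambda>_. 0) sequentially"
    and B0: "uniform_limit {a..b} (\<lambda>r. B (Suc r)) (\<lambda>_. 0) sequentially"
    using A0 B0 by (simp_all add: A_def[abs_def] B_def[abs_def])
  have left: "(left_frac_integral (real (Suc r) + 1 - \<alpha>) a f has_vector_derivative
      left_frac_integral (real (Suc r) - \<alpha>) a f x) (at x within {a..b})"
    and right: "(right_frac_integral (real (Suc r) + 1 - \<alpha>) b g has_vector_derivative
      - right_frac_integral (real (Suc r) - \<alpha>) b g x) (at x within {a..b})"
    if "x \<in> {a..b}" for x r
    using left_frac_integral_has_vector_derivative[OF _ that smooth_curve_on_derivs(1)[OF f],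
        of "real (Suc r) - \<alpha>"]
      right_frac_integral_has_vector_derivative[OF _ that smooth_curve_on_derivs(1)[OF g],
        of "real (Suc r) - \<alpha>"]
      smooth_curve_on_continuous[OF f, of 1] smooth_curve_on_continuous[OF g, of 1] \<alpha>
    by (simp_all only: diff_add_eq[symmetric])
  \<comment> \<open>From \<open>r = 1\<close> on, the orders of integration are at least 1, so the terms are differentiable up
    to the end points. The terms for \<open>r = 0\<close> may be singular there and are added at the end.\<close>
  have du: "(u (Suc r) has_real_derivative
      (- 1) ^ Suc r * A (Suc (Suc r)) x - (- 1) ^ r * A (Suc r) x) (at x within {a..b})"
    if x: "x \<in> {a..b}" for r x
  proof -
    have "(u (Suc r) has_vector_derivative (- 1) ^ Suc r *
        (left_frac_integral (real (Suc r) + 1 - \<alpha>) a f x \<bullet> nth_deriv (Suc (Suc r)) {a..b} g x +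
         left_frac_integral (real (Suc r) - \<alpha>) a f x \<bullet> nth_deriv (Suc r) {a..b} g x))
        (at x within {a..b})"
      unfolding u_def[abs_def]
      by (intro bounded_linear.has_vector_derivative[OF bounded_linear_mult_right]
          inner left smooth_curve_on_has_vector_derivative g x)
    moreover have "real (Suc r) + 1 = real (Suc (Suc r))" by simp
    ultimately show ?thesis
      unfolding has_real_derivative_iff_has_vector_derivative A_def
      by (simp only: distrib_left) simp
  qed
  have Eu: "uniform_limit {a..b} (\<lambda>r t. (- 1) ^ r * A (Suc r) t) (\<lambda>_. 0) sequentially"
    using A0 by (simp add: uniform_limit_iff abs_mult power_abs)
  have aI: "a \<in> {a..b}" and bI: "b \<in> {a..b}" using t by simp_all
  have ua: "u (Suc r) a = 0" for r
    using \<alpha> by (simp add: u_def left_frac_integral_def)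
  have U: "summable (\<lambda>r. u (Suc r) x)"
    "((\<lambda>x. \<Sum>r. u (Suc r) x) has_real_derivative - ((- 1) ^ 0 * A (Suc 0) x)) (at x within {a..b})"
    if "x \<in> {a..b}" for x
    using telescoping_series_has_derivative[where c = "\<lambda>r. u (Suc r)" and
        E = "\<lambda>r t. (- 1) ^ r * A (Suc r) t", OF du Eu aI ua that]
    by simp_all
  have dw: "(w (Suc r) has_real_derivative B (Suc (Suc r)) x - B (Suc r) x) (at x within {a..b})"
    if x: "x \<in> {a..b}" for r x
  proof -
    have "(w (Suc r) has_vector_derivative
        nth_deriv (Suc r) {a..b} f x \<bullet> - right_frac_integral (real (Suc r) - \<alpha>) b g x +
        nth_deriv (Suc (Suc r)) {a..b} f x \<bullet> right_frac_integral (real (Suc r) + 1 - \<alpha>) b g x)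
        (at x within {a..b})"
      unfolding w_def[abs_def]
      by (intro inner right smooth_curve_on_has_vector_derivative f x)
    moreover have "real (Suc r) + 1 = real (Suc (Suc r))" by simp
    ultimately show ?thesis
      unfolding has_real_derivative_iff_has_vector_derivative B_def
      by (simp only: inner_minus_right add.commute uminus_add_conv_diff)
  qed
  have wb: "w (Suc r) b = 0" for r
    using \<alpha> by (simp add: w_def right_frac_integral_def)
  have W: "summable (\<lambda>r. w (Suc r) x)"
    "((\<lambda>x. \<Sum>r. w (Suc r) x) has_real_derivative - B (Suc 0) x) (at x within {a..b})"
    if "x \<in> {a..b}" for x
    using telescoping_series_has_derivative[where c = "\<lambda>r. w (Suc r)" and
        E = "\<lambda>r. B (Suc r)", OF dw B0 bI wb that]
    by simp_all
  let ?Df = "left_frac_deriv \<alpha> a b f t"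
  have sum: "summable (\<lambda>r. u r x + w r x)"
    "(\<Sum>r. u r x + w r x) = u 0 x + w 0 x + (\<Sum>r. u (Suc r) x) + (\<Sum>r. w (Suc r) x)"
    if x: "x \<in> {a..b}" for x
  proof -
    have s: "summable (\<lambda>r. u r x)" "summable (\<lambda>r. w r x)"
      using U(1)[OF x] W(1)[OF x] summable_Suc_iff[of "\<lambda>r. u r x"]
        summable_Suc_iff[of "\<lambda>r. w r x"] by blast+
    then show "summable (\<lambda>r. u r x + w r x)" by (rule summable_add)
    show "(\<Sum>r. u r x + w r x) = u 0 x + w 0 x + (\<Sum>r. u (Suc r) x) + (\<Sum>r. w (Suc r) x)"
      using suminf_add[OF s] suminf_split_head[OF s(1)] suminf_split_head[OF s(2)]
      by simp
  qed
  have "(left_frac_integral (1 - \<alpha>) a f has_vector_derivative ?Df) (at t)"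
    by (rule left_frac_deriv_eq(1)[OF \<alpha> t smooth_curve_on_derivs[OF f] smooth_curve_on_continuous[OF f]])
  moreover have "(nth_deriv 0 {a..b} g has_vector_derivative nth_deriv 1 {a..b} g t) (at t)"
    using smooth_curve_on_has_vector_derivative[OF g tI, of 0] at by simp
  ultimately have "((\<lambda>x. left_frac_integral (1 - \<alpha>) a f x \<bullet> nth_deriv 0 {a..b} g x) has_vector_derivative
      left_frac_integral (1 - \<alpha>) a f t \<bullet> nth_deriv 1 {a..b} g t + ?Df \<bullet> nth_deriv 0 {a..b} g t) (at t)"
    by (rule inner)
  then have u0: "(u 0 has_real_derivative A (Suc 0) t + ?Df \<bullet> g t) (at t)"
    by (simp add: u_def[abs_def] A_def has_real_derivative_iff_has_vector_derivative)
  have "(nth_deriv 0 {a..b} f has_vector_derivative nth_deriv 1 {a..b} f t) (at t)"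
    using smooth_curve_on_has_vector_derivative[OF f tI, of 0] at by simp
  from this Dg have "((\<lambda>x. nth_deriv 0 {a..b} f x \<bullet> right_frac_integral (1 - \<alpha>) b g x) has_vector_derivative
      nth_deriv 0 {a..b} f t \<bullet> - Dg + nth_deriv 1 {a..b} f t \<bullet> right_frac_integral (1 - \<alpha>) b g t) (at t)"
    by (intro inner)
  then have w0: "(w 0 has_real_derivative B (Suc 0) t - f t \<bullet> Dg) (at t)"
    by (simp add: w_def[abs_def] B_def has_real_derivative_iff_has_vector_derivative)
  have "((\<lambda>x. u 0 x + w 0 x + (\<Sum>r. u (Suc r) x) + (\<Sum>r. w (Suc r) x)) has_real_derivative
      ?Df \<bullet> g t - f t \<bullet> Dg) (at t)"
    using DERIV_add[OF DERIV_add[OF DERIV_add[OF u0 w0] U(2)[OF tI, unfolded at]] W(2)[OF tI, unfolded at]]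
    by simp
  then show "((\<lambda>t. \<Sum>r. u r t + w r t) has_real_derivative ?Df \<bullet> g t - f t \<bullet> Dg) (at t)"
    by (rule has_field_derivative_transform_within_open[where S = "{a<..<b}"]) (use t sum(2) in auto)
  show "summable (\<lambda>r. u r t + w r t)" by (rule sum(1)[OF tI])
qed

section \<open>Variations of curves under a fractional derivative\<close>

lemma left_frac_integral_existsI:
  fixes f f' :: "real \<Rightarrow> 'b::euclidean_space"
  assumes "0 \<le> \<beta>" and "t \<in> {a..b}"
    and "\<And>u. u \<in> {a..b} \<Longrightarrow> (f has_vector_derivative f' u) (at u within {a..b})"
    and "continuous_on {a..b} f'"
  shows "left_frac_integral_exists \<beta> a f t"
  using left_frac_kernel_integrable[OF _ assms(2-4), of \<beta>] assms(1)
  by (auto simp: left_frac_integral_exists_def less_le)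

lemma left_frac_integral_difference_quotient:
  fixes f g :: "real \<Rightarrow> 'b::euclidean_space"
  assumes "left_frac_integral_exists \<beta> a f t" "left_frac_integral_exists \<beta> a g t"
  shows "left_frac_integral_exists \<beta> a (\<lambda>u. (f u - g u) /\<^sub>R s) t"
    and "left_frac_integral \<beta> a (\<lambda>u. (f u - g u) /\<^sub>R s) t =
      (left_frac_integral \<beta> a f t - left_frac_integral \<beta> a g t) /\<^sub>R s"
proof -
  let ?k = "\<lambda>h y. (t - y) powr (\<beta> - 1) *\<^sub>R h y"
  have eq: "?k (\<lambda>u. (f u - g u) /\<^sub>R s) = (\<lambda>y. inverse s *\<^sub>R (?k f y - ?k g y))"
    by (simp add: scaleR_right_diff_distrib mult.commute)
  have J: "((\<lambda>y. inverse s *\<^sub>R (?k f y - ?k g y)) has_integral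
      inverse s *\<^sub>R (integral {a..t} (?k f) - integral {a..t} (?k g))) {a..t}" if "\<beta> \<noteq> 0"
    using assms that
    by (intro has_integral_cmul has_integral_diff integrable_integral)
      (auto simp: left_frac_integral_exists_def)
  have I: "(?k (\<lambda>u. (f u - g u) /\<^sub>R s) has_integral
      inverse s *\<^sub>R (integral {a..t} (?k f) - integral {a..t} (?k g))) {a..t}" if "\<beta> \<noteq> 0"
    unfolding eq by (rule J[OF that])
  show "left_frac_integral_exists \<beta> a (\<lambda>u. (f u - g u) /\<^sub>R s) t"
    using I by (auto simp: left_frac_integral_exists_def)
  show "left_frac_integral \<beta> a (\<lambda>u. (f u - g u) /\<^sub>R s) t =
      (left_frac_integral \<beta> a f t - left_frac_integral \<beta> a g t) /\<^sub>R s"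
  proof (cases "\<beta> = 0")
    case True
    then show ?thesis by (simp add: left_frac_integral_def)
  next
    case False
    from integral_unique[OF I[OF False]] False show ?thesis
      by (simp only: left_frac_integral_def if_False) (simp add: scaleR_right_diff_distrib mult.commute)
  qed
qed

text \<open>
  The kernel is absolutely integrable, so uniformly small integrands have small fractional integrals.
\<close>

lemma left_frac_integral_uniform_limit:
  fixes k :: "'s \<Rightarrow> real \<Rightarrow> 'b::euclidean_space"
  assumes \<beta>: "0 \<le> \<beta>" and t: "t \<in> {a..b}"
    and k: "\<And>s. left_frac_integral_exists \<beta> a (k s) t"
    and m: "left_frac_integral_exists \<beta> a m t"
    and lim: "uniform_limit {a..b} k m F"
  shows "((\<lambda>s. left_frac_integral \<beta> a (k s) t) \<longlongrightarrow> left_frac_integral \<beta> a m t) F"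
proof (cases "\<beta> = 0")
  case True
  then show ?thesis
    using tendsto_uniform_limitI[OF lim t] by (simp add: left_frac_integral_def)
next
  case False
  then have \<beta>: "0 < \<beta>" using \<beta> by simp
  let ?w = "\<lambda>y. (t - y) powr (\<beta> - 1)"
  define W where "W = integral {a..t} ?w"
  have w: "?w integrable_on {a..t}"
    using left_frac_kernel_integrable[OF \<beta> t, of "\<lambda>_. 1::real" "\<lambda>_. 0"]
    by simp
  have "W \<ge> 0" unfolding W_def by (rule integral_nonneg[OF w]) simp
  have G: "Gamma \<beta> > 0" using Gamma_real_pos[OF \<beta>] .
  show ?thesis
  proof (rule tendstoI)
    fix e :: real assume e: "e > 0"
    define e' where "e' = e * Gamma \<beta> / (W + 1)"
    have "e' > 0" using e G \<open>W \<ge> 0\<close> by (simp add: e'_def)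
    show "\<forall>\<^sub>F s in F. dist (left_frac_integral \<beta> a (k s) t) (left_frac_integral \<beta> a m t) < e"
      using uniform_limitD[OF lim \<open>e' > 0\<close>]
    proof eventually_elim
      case (elim s)
      let ?I = "\<lambda>h. integral {a..t} (\<lambda>y. ?w y *\<^sub>R h y)"
      have int: "(\<lambda>y. ?w y *\<^sub>R k s y) integrable_on {a..t}" "(\<lambda>y. ?w y *\<^sub>R m y) integrable_on {a..t}"
        using k[of s] m False by (auto simp: left_frac_integral_exists_def)
      have "norm (?I (k s) - ?I m) = norm (integral {a..t} (\<lambda>y. ?w y *\<^sub>R k s y - ?w y *\<^sub>R m y))"
        using Henstock_Kurzweil_Integration.integral_diff[OF int] by simp
      also have "\<dots> \<le> integral {a..t} (\<lambda>y. e' *\<^sub>R ?w y)"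
      proof (rule Henstock_Kurzweil_Integration.integral_norm_bound_integral)
        show "(\<lambda>y. ?w y *\<^sub>R k s y - ?w y *\<^sub>R m y) integrable_on {a..t}"
          by (rule integrable_diff[OF int])
        show "(\<lambda>y. e' *\<^sub>R ?w y) integrable_on {a..t}" by (rule integrable_cmul[OF w])
        fix y assume "y \<in> {a..t}"
        then have "norm (k s y - m y) \<le> e'"
          using elim t by (auto simp: dist_norm intro: less_imp_le)
        then have "?w y * norm (k s y - m y) \<le> ?w y * e'"
          by (intro mult_left_mono) auto
        then show "norm (?w y *\<^sub>R k s y - ?w y *\<^sub>R m y) \<le> e' *\<^sub>R ?w y"
          by (simp add: scaleR_right_diff_distrib[symmetric] mult.commute)
      qed
      also have "\<dots> = e' * W" by (simp add: W_def)
      finally have *: "norm (?I (k s) - ?I m) \<le> e' * W" .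
      have "dist (left_frac_integral \<beta> a (k s) t) (left_frac_integral \<beta> a m t) =
          norm ((1 / Gamma \<beta>) *\<^sub>R (?I (k s) - ?I m))"
        using False by (simp add: left_frac_integral_def dist_norm scaleR_right_diff_distrib)
      also have "\<dots> = norm (?I (k s) - ?I m) / Gamma \<beta>" using G by simp
      also have "\<dots> \<le> e' * W / Gamma \<beta>" using * G by (intro divide_right_mono) auto
      also have "\<dots> = e * (W / (W + 1))" using G by (simp add: e'_def)
      also have "\<dots> < e * 1" using e \<open>W \<ge> 0\<close> by (intro mult_strict_left_mono) auto
      finally show ?case by simp
    qed
  qed
qed

lemma has_vector_derivative_at_0_iff:
  "(f has_vector_derivative D) (at 0) \<longleftrightarrow> ((\<lambda>s. (f s - f 0) /\<^sub>R s) \<longlongrightarrow> D) (at 0)"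
proof -
  have "norm (f h - f 0 - h *\<^sub>R D) / norm h = norm ((f h - f 0) /\<^sub>R h - D)" if "h \<noteq> 0" for h
  proof -
    have "f h - f 0 - h *\<^sub>R D = h *\<^sub>R ((f h - f 0) /\<^sub>R h - D)"
      using that by (simp add: scaleR_right_diff_distrib)
    then show ?thesis using that by (simp only: norm_scaleR) simp
  qed
  then have "(f has_vector_derivative D) (at 0) \<longleftrightarrow>
      ((\<lambda>s. norm ((f s - f 0) /\<^sub>R s - D)) \<longlongrightarrow> 0) (at 0)"
    unfolding has_vector_derivative_def has_derivative_at
    by (simp add: bounded_linear_scaleR_left cong: LIM_cong)
  then show ?thesis by (simp only: tendsto_norm_zero_iff LIM_zero_iff)
qed

text \<open>
  By the mean value inequality the error of the difference quotient at \<open>u\<close> is at most the oscillation of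
  \<open>M\<close> between \<open>(0, u)\<close> and \<open>(s, u)\<close>, which uniform continuity on a compact rectangle controls for
  all \<open>u\<close> at once.
\<close>

lemma difference_quotient_uniform_limit:
  fixes G M :: "real \<Rightarrow> real \<Rightarrow> 'b::real_normed_vector"
  assumes G: "\<And>s u. u \<in> {a..b} \<Longrightarrow> ((\<lambda>s. G s u) has_vector_derivative M s u) (at s)"
    and M: "continuous_on (UNIV \<times> {a..b}) (\<lambda>(s, u). M s u)"
  shows "uniform_limit {a..b} (\<lambda>s u. (G s u - G 0 u) /\<^sub>R s) (M 0) (at 0)"
proof (rule uniform_limitI)
  fix e :: real assume e: "e > 0"
  have "uniformly_continuous_on ({-1..1} \<times> {a..b}) (\<lambda>(s, u). M s u)"
    by (rule compact_uniformly_continuous)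
      (auto intro: continuous_on_subset[OF M] compact_Times)
  then obtain d where d: "d > 0"
    "\<And>x x'. \<lbrakk>x \<in> {-1..1} \<times> {a..b}; x' \<in> {-1..1} \<times> {a..b}; dist x' x < d\<rbrakk> \<Longrightarrow>
       dist ((\<lambda>(s, u). M s u) x') ((\<lambda>(s, u). M s u) x) < e / 2"
    using e unfolding uniformly_continuous_on_def by (metis half_gt_zero)
  have "\<forall>\<^sub>F s in at (0::real). s \<noteq> 0 \<and> dist s 0 < min 1 d"
    using d(1) by (auto simp: eventually_at intro!: exI[of _ "min 1 d"])
  then show "\<forall>\<^sub>F s in at 0. \<forall>u\<in>{a..b}. dist ((G s u - G 0 u) /\<^sub>R s) (M 0 u) < e"
  proof eventually_elim
    case (elim s)
    show ?case
    proof
      fix u assume u: "u \<in> {a..b}"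
      have "norm (G s u - G 0 u - (s - 0) *\<^sub>R M 0 u) \<le> norm (s - 0) * (e / 2)"
      proof (rule vector_differentiable_bound_linearization[where S = "closed_segment 0 s"
            and f' = "\<lambda>s. M s u" and ?x0.0 = 0])
        show "((\<lambda>s. G s u) has_vector_derivative M x u) (at x within closed_segment 0 s)" for x
          using G[OF u] by (rule has_vector_derivative_at_within)
        fix x assume "x \<in> closed_segment 0 s"
        then have "\<bar>x\<bar> \<le> \<bar>s\<bar>" by (auto simp: closed_segment_eq_real_ivl split: if_splits)
        then have "x \<in> {-1..1}" "\<bar>x\<bar> < d" using elim by auto
        then show "norm (M x u - M 0 u) \<le> e / 2"
          using d(2)[of "(0, u)" "(x, u)"] u
          by (auto simp: dist_norm dist_Pair_Pair)
      qed auto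
      then have "norm (s *\<^sub>R ((G s u - G 0 u) /\<^sub>R s - M 0 u)) \<le> \<bar>s\<bar> * (e / 2)"
        using elim by (simp add: scaleR_right_diff_distrib)
      then have "norm ((G s u - G 0 u) /\<^sub>R s - M 0 u) \<le> e / 2"
        using elim by (simp del: times_divide_eq_right)
      then show "dist ((G s u - G 0 u) /\<^sub>R s) (M 0 u) < e"
        using e by (simp add: dist_norm)
    qed
  qed
qed

text \<open>
  A form of the equality of mixed partial derivatives: the \<open>s\<close>-derivative \<open>f\<close> of the curves \<open>h s\<close> is
  the limit of the difference quotients, whose \<open>u\<close>-derivatives converge uniformly to \<open>m\<close>.
\<close>

lemma variation_has_vector_derivative:
  fixes h G :: "real \<Rightarrow> real \<Rightarrow> 'b::euclidean_space"
  assumes h: "\<And>s u. u \<in> {a..b} \<Longrightarrow> (h s has_vector_derivative G s u) (at u within {a..b})"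
    and f: "\<And>u. u \<in> {a..b} \<Longrightarrow> ((\<lambda>s. h s u) has_vector_derivative f u) (at 0)"
    and lim: "uniform_limit {a..b} (\<lambda>s u. (G s u - G 0 u) /\<^sub>R s) m (at 0)"
    and u: "u \<in> {a..b}"
  shows "(f has_vector_derivative m u) (at u within {a..b})"
proof -
  define \<sigma> where "\<sigma> n = inverse (real (Suc n))" for n
  have \<sigma>: "filterlim \<sigma> (at 0) sequentially"
    unfolding filterlim_at \<sigma>_def using LIMSEQ_inverse_real_of_nat by auto
  let ?k = "\<lambda>n x. (h (\<sigma> n) x - h 0 x) /\<^sub>R \<sigma> n"
  have k: "(\<lambda>n. ?k n x) \<longlonglongrightarrow> f x" if "x \<in> {a..b}" for x
    using f[OF that, unfolded has_vector_derivative_at_0_iff] \<sigma> by (rule filterlim_compose)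
  have "\<exists>g. \<forall>x\<in>{a..b}. (\<lambda>n. ?k n x) \<longlonglongrightarrow> g x \<and>
      (g has_derivative (\<lambda>r. r *\<^sub>R m x)) (at x within {a..b})"
  proof (rule has_derivative_sequence)
    show "(?k n has_derivative (\<lambda>r. r *\<^sub>R ((G (\<sigma> n) x - G 0 x) /\<^sub>R \<sigma> n))) (at x within {a..b})"
      if "x \<in> {a..b}" for n x
      using bounded_linear.has_vector_derivative[OF bounded_linear_scaleR_right
          has_vector_derivative_diff[OF h[OF that] h[OF that]]]
      unfolding has_vector_derivative_def .
    show "\<forall>\<^sub>F n in sequentially. \<forall>x\<in>{a..b}. \<forall>r.
        norm (r *\<^sub>R ((G (\<sigma> n) x - G 0 x) /\<^sub>R \<sigma> n) - r *\<^sub>R m x) \<le> e * norm r" if "e > 0" for e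
      using eventually_compose_filterlim[OF uniform_limitD[OF lim that] \<sigma>]
    proof eventually_elim
      case (elim n)
      show ?case
      proof (intro ballI allI)
        fix x r :: real assume "x \<in> {a..b}"
        then have "norm ((G (\<sigma> n) x - G 0 x) /\<^sub>R \<sigma> n - m x) \<le> e"
          using elim by (auto simp: dist_norm intro: less_imp_le)
        then have "\<bar>r\<bar> * norm ((G (\<sigma> n) x - G 0 x) /\<^sub>R \<sigma> n - m x) \<le> \<bar>r\<bar> * e"
          by (rule mult_left_mono) simp
        then show "norm (r *\<^sub>R ((G (\<sigma> n) x - G 0 x) /\<^sub>R \<sigma> n) - r *\<^sub>R m x) \<le> e * norm r"
          by (simp only: scaleR_right_diff_distrib[symmetric] norm_scaleR real_norm_def mult.commute)
      qed
    qed
  qed (use u k in auto)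
  then obtain g where g: "\<And>x. x \<in> {a..b} \<Longrightarrow> (\<lambda>n. ?k n x) \<longlonglongrightarrow> g x"
      "\<And>x. x \<in> {a..b} \<Longrightarrow> (g has_vector_derivative m x) (at x within {a..b})"
    unfolding has_vector_derivative_def by blast
  have "f x = g x" if "x \<in> {a..b}" for x
    using LIMSEQ_unique[OF k[OF that] g(1)[OF that]] .
  then show ?thesis
    using has_vector_derivative_transform[OF u _ g(2)[OF u]] by metis
qed

text \<open>
  The fractional derivative commutes with the derivative in a parameter: its boundary term sees
  only the values at \<open>a\<close>, and its integral term is continuous under the uniform convergence of the
  difference quotients of the velocities \<open>G s\<close>.
\<close>

lemma left_frac_deriv_variation:
  fixes h G H M :: "real \<Rightarrow> real \<Rightarrow> 'b::euclidean_space"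
  assumes \<alpha>: "\<alpha> \<le> 1" and t: "t \<in> {a<..<b}"
    and h: "\<And>s u. u \<in> {a..b} \<Longrightarrow> (h s has_vector_derivative G s u) (at u within {a..b})"
    and G: "\<And>s u. u \<in> {a..b} \<Longrightarrow> (G s has_vector_derivative H s u) (at u within {a..b})"
    and H: "\<And>s. continuous_on {a..b} (H s)"
    and f: "\<And>u. u \<in> {a..b} \<Longrightarrow> ((\<lambda>s. h s u) has_vector_derivative f u) (at 0)"
    and GM: "\<And>s u. u \<in> {a..b} \<Longrightarrow> ((\<lambda>s. G s u) has_vector_derivative M s u) (at s)"
    and M: "continuous_on (UNIV \<times> {a..b}) (\<lambda>(s, u). M s u)"
    and f': "\<And>u. u \<in> {a..b} \<Longrightarrow> (f has_vector_derivative f' u) (at u within {a..b})"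
    and f'': "\<And>u. u \<in> {a..b} \<Longrightarrow> (f' has_vector_derivative f'' u) (at u within {a..b})"
    and cf: "continuous_on {a..b} f''"
  shows "((\<lambda>s. left_frac_deriv \<alpha> a b (h s) t) has_vector_derivative left_frac_deriv \<alpha> a b f t) (at 0)"
proof -
  have ab: "a < b" and tI: "t \<in> {a..b}" and \<beta>: "0 \<le> 1 - \<alpha>" and aI: "a \<in> {a..b}" using t \<alpha> by auto
  let ?q = "\<lambda>s u. (G s u - G 0 u) /\<^sub>R s"
  let ?c = "(t - a) powr (- \<alpha>) / Gamma (1 - \<alpha>)"
  let ?I = "\<lambda>k. left_frac_integral (1 - \<alpha>) a k t"
  note lim = difference_quotient_uniform_limit[OF GM M]
  have "M 0 u = f' u" if u: "u \<in> {a..b}" for u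
    using vector_derivative_unique_within_closed_interval[of a b u f] ab u f'[OF u]
      variation_has_vector_derivative[OF h f lim u] by simp
  then have lim': "uniform_limit {a..b} ?q f' (at 0)"
    by (intro uniform_limit_cong'[THEN iffD1, OF _ _ lim]) auto
  have D: "left_frac_deriv \<alpha> a b (h s) t = ?c *\<^sub>R h s a + ?I (G s)" for s
    by (rule left_frac_deriv_eq(2)[OF \<alpha> t h G H])
  have Df: "left_frac_deriv \<alpha> a b f t = ?c *\<^sub>R f a + ?I f'"
    by (rule left_frac_deriv_eq(2)[OF \<alpha> t f' f'' cf])
  have ex: "left_frac_integral_exists (1 - \<alpha>) a (G s) t" for s
    by (rule left_frac_integral_existsI[OF \<beta> tI G H])
  have "((\<lambda>s. ?I (?q s)) \<longlongrightarrow> ?I f') (at 0)"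
    by (rule left_frac_integral_uniform_limit[OF \<beta> tI _ _ lim'])
      (auto intro: left_frac_integral_difference_quotient ex left_frac_integral_existsI[OF \<beta> tI f'' cf])
  then have "((\<lambda>s. ?c *\<^sub>R ((h s a - h 0 a) /\<^sub>R s) + ?I (?q s)) \<longlongrightarrow> ?c *\<^sub>R f a + ?I f') (at 0)"
    using f[OF aI, unfolded has_vector_derivative_at_0_iff] by (intro tendsto_intros)
  moreover have "?c *\<^sub>R ((h s a - h 0 a) /\<^sub>R s) + ?I (?q s) =
      (left_frac_deriv \<alpha> a b (h s) t - left_frac_deriv \<alpha> a b (h 0) t) /\<^sub>R s" for s
    unfolding D left_frac_integral_difference_quotient(2)[OF ex ex]
    by (simp add: scaleR_right_diff_distrib scaleR_right_distrib mult.commute)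
  ultimately show ?thesis
    unfolding has_vector_derivative_at_0_iff Df by simp
qed

lemma has_vector_derivative_blinfun:
  fixes D :: "real \<Rightarrow>\<^sub>L 'b::real_normed_vector"
  assumes "(q has_derivative blinfun_apply D) (at u within S)"
  shows "(q has_vector_derivative blinfun_apply D 1) (at u within S)"
  using assms by (simp add: has_vector_derivative_def blinfun.scaleR_right[symmetric])

text \<open>
  Since the flow and the curve are of class C2, the velocities of the curves \<open>\<phi> s \<circ> q\<close> are of class
  C1 both in \<open>s\<close> and in \<open>u\<close>: the first is what their difference quotients need, the second what the
  integration by parts of the fractional integral needs.
\<close>

lemma left_frac_deriv_group_variation:
  fixes \<phi> :: "real \<Rightarrow> 'b::euclidean_space \<Rightarrow> 'b"
  assumes \<alpha>: "\<alpha> \<le> 1" and t: "t \<in> {a<..<b}"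
    and \<phi>: "C2_on UNIV (\<lambda>(s, x). \<phi> s x)"
    and q: "C2_on {a..b} q"
    and f: "\<And>u. u \<in> {a..b} \<Longrightarrow> f u = vector_derivative (\<lambda>s. \<phi> s (q u)) (at 0)"
    and smooth: "smooth_curve_on {a..b} f"
  shows "((\<lambda>s. \<phi> s (q t)) has_vector_derivative f t) (at 0)"
    and "((\<lambda>s. left_frac_deriv \<alpha> a b (\<lambda>u. \<phi> s (q u)) t) has_vector_derivative
           left_frac_deriv \<alpha> a b f t) (at 0)"
proof -
  obtain P and P' :: "real \<times> 'b \<Rightarrow> (real \<times> 'b) \<Rightarrow>\<^sub>L (real \<times> 'b) \<Rightarrow>\<^sub>L 'b"
    where P: "\<And>z. ((\<lambda>(s, x). \<phi> s x) has_derivative blinfun_apply (P z)) (at z)"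
      and P': "\<And>z. (P has_derivative blinfun_apply (P' z)) (at z)"
      and cP': "continuous_on UNIV P'"
    using \<phi> unfolding C2_on_def C1_on_def by blast
  obtain Q and Q' :: "real \<Rightarrow> real \<Rightarrow>\<^sub>L real \<Rightarrow>\<^sub>L 'b"
    where Q: "\<And>u. u \<in> {a..b} \<Longrightarrow> (q has_derivative blinfun_apply (Q u)) (at u within {a..b})"
      and Q': "\<And>u. u \<in> {a..b} \<Longrightarrow> (Q has_derivative blinfun_apply (Q' u)) (at u within {a..b})"
      and cQ': "continuous_on {a..b} Q'"
    using q unfolding C2_on_def C1_on_def by blast
  note bl = bounded_bilinear.has_vector_derivative[OF bounded_bilinear_blinfun_apply]
  define q' where "q' u = Q u 1" for u
  define q'' where "q'' u = Q' u 1 1" for u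
  have q': "(q has_vector_derivative q' u) (at u within {a..b})" if "u \<in> {a..b}" for u
    unfolding q'_def using has_vector_derivative_blinfun[OF Q[OF that]] .
  have q'': "(q' has_vector_derivative q'' u) (at u within {a..b})" if "u \<in> {a..b}" for u
    using bl[OF has_vector_derivative_blinfun[OF Q'[OF that]] has_vector_derivative_const[of 1]]
    by (simp add: q'_def[abs_def] q''_def blinfun.zero_right)
  have cq: "continuous_on {a..b} q" "continuous_on {a..b} q'"
    using q' q'' continuous_on_vector_derivative by blast+
  have cq'': "continuous_on {a..b} q''"
    unfolding q''_def by (intro continuous_intros cQ')
  \<comment> \<open>\<open>G\<close> is the velocity of \<open>\<phi> s \<circ> q\<close>; \<open>H\<close> and \<open>M\<close> are its derivatives in \<open>u\<close> and in \<open>s\<close>. All of them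
    are given by the chain rule from the first two derivatives \<open>P\<close>, \<open>P'\<close> of the flow.\<close>
  define G where "G s u = P (s, q u) (0, q' u)" for s u
  define H where "H s u = P (s, q u) (0, q'' u) + P' (s, q u) (0, q' u) (0, q' u)" for s u
  define M where "M s u = P' (s, q u) (1, 0) (0, q' u)" for s u
  have cP: "continuous_on UNIV P"
    using P' by (meson continuous_at_imp_continuous_on has_derivative_continuous)
  have along_u: "((\<lambda>u. (s, q u)) has_vector_derivative (0, q' u)) (at u within {a..b})"
    if "u \<in> {a..b}" for s u
    by (intro has_vector_derivative_Pair q' that has_vector_derivative_const)
  have along_s: "((\<lambda>s. (s, x)) has_vector_derivative (1, 0)) (at s)" for s :: real and x :: 'b
    by (intro has_vector_derivative_Pair has_vector_derivative_const has_vector_derivative_id)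
  have h: "((\<lambda>u. \<phi> s (q u)) has_vector_derivative G s u) (at u within {a..b})"
    if "u \<in> {a..b}" for s u
    using vector_derivative_diff_chain_within[OF along_u[OF that] has_derivative_at_withinI[OF P]]
    by (simp add: o_def G_def)
  have "((\<lambda>s. \<phi> s (q u)) has_vector_derivative P (0, q u) (1, 0)) (at 0)" for u
    using vector_derivative_diff_chain_within[OF along_s has_derivative_at_withinI[OF P]]
    by (simp add: o_def)
  then have hf: "((\<lambda>s. \<phi> s (q u)) has_vector_derivative f u) (at 0)" if "u \<in> {a..b}" for u
    using f[OF that] vector_derivative_at by metis
  have Pu: "((\<lambda>u. P (s, q u)) has_vector_derivative P' (s, q u) (0, q' u)) (at u within {a..b})"
    if "u \<in> {a..b}" for s u
    using vector_derivative_diff_chain_within[OF along_u[OF that] has_derivative_at_withinI[OF P']]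
    by (simp add: o_def)
  have G: "(G s has_vector_derivative H s u) (at u within {a..b})" if "u \<in> {a..b}" for s u
    unfolding G_def H_def
    by (intro bl Pu has_vector_derivative_Pair q'' that has_vector_derivative_const)
  have "((\<lambda>s. P (s, q u)) has_vector_derivative P' (s, q u) (1, 0)) (at s)" for s u
    using vector_derivative_diff_chain_within[OF along_s has_derivative_at_withinI[OF P']]
    by (simp add: o_def)
  from bl[OF this has_vector_derivative_const]
  have GM: "((\<lambda>s. G s u) has_vector_derivative M s u) (at s)" for s u
    by (simp add: G_def M_def blinfun.zero_right)
  have cH: "continuous_on {a..b} (H s)" for s
    unfolding H_def
    by (intro continuous_intros cq cq'' continuous_on_compose2[OF cP] continuous_on_compose2[OF cP']) auto
  have snd: "continuous_on (UNIV \<times> {a..b}) (\<lambda>z::real \<times> real. k (snd z))"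
    if "continuous_on {a..b} k" for k :: "real \<Rightarrow> 'b"
    by (rule continuous_on_compose2[OF that]) (auto intro: continuous_intros)
  have cM: "continuous_on (UNIV \<times> {a..b}) (\<lambda>(s, u). M s u)"
    unfolding M_def case_prod_unfold
    by (intro continuous_intros snd cq continuous_on_compose2[OF cP']) auto
  show "((\<lambda>s. \<phi> s (q t)) has_vector_derivative f t) (at 0)" using hf t by auto
  show "((\<lambda>s. left_frac_deriv \<alpha> a b (\<lambda>u. \<phi> s (q u)) t) has_vector_derivative
      left_frac_deriv \<alpha> a b f t) (at 0)"
    by (rule left_frac_deriv_variation[OF \<alpha> t h G cH hf GM cM smooth_curve_on_derivs[OF smooth]
          smooth_curve_on_continuous[OF smooth, of 2]])
qed

section \<open>The infinitesimal form of the invariance\<close>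

lemma gradient_inner:
  fixes h :: "'b::euclidean_space \<Rightarrow> real"
  assumes "(h has_derivative D) (at x)"
  shows "gradient h x \<bullet> k = D k"
proof -
  have D: "D k = k \<bullet> adjoint D 1" for k
    using adjoint_works[OF has_derivative_linear[OF assms], of k 1] by simp
  then have "GDERIV h x :> adjoint D 1"
    using assms by (simp add: gderiv_def flip: fun_eq_iff D)
  moreover have "E = adjoint D 1" if "GDERIV h x :> E" for E
  proof -
    have "D = (\<lambda>k. k \<bullet> E)"
      using has_derivative_unique[OF assms] that by (simp add: gderiv_def)
    then show ?thesis by (metis D vector_eq_rdot inner_commute)
  qed
  ultimately have "gradient h x = adjoint D 1"
    unfolding gradient_def by (rule the_equality)
  then show ?thesis using D[of k] by (simp add: inner_commute)
qed

text \<open>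
  The chain rule along curves in the slice at time \<open>t\<close>. Such curves stay in the closed strip on which
  \<open>L\<close> is differentiable, so one-sided derivatives in time at its boundary do no harm.
\<close>

lemma stationary_along_curve:
  fixes L :: "'b::euclidean_space \<times> 'b \<times> real \<Rightarrow> real"
  assumes L: "C2_on (UNIV \<times> UNIV \<times> {a..b}) L" and t: "t \<in> {a..b}"
    and X: "(X has_vector_derivative X') (at 0)"
    and V: "(V has_vector_derivative V') (at 0)"
    and const: "\<And>s. L (X s, V s, t) = L (X 0, V 0, t)"
  shows "gradient (\<lambda>x. L (x, V 0, t)) (X 0) \<bullet> X' + gradient (\<lambda>v. L (X 0, v, t)) (V 0) \<bullet> V' = 0"
proof -
  let ?S = "UNIV \<times> UNIV \<times> {a..b} :: ('b \<times> 'b \<times> real) set"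
  obtain L' :: "'b \<times> 'b \<times> real \<Rightarrow> ('b \<times> 'b \<times> real) \<Rightarrow>\<^sub>L real"
    where "\<And>z. z \<in> ?S \<Longrightarrow> (L has_derivative L' z) (at z within ?S)"
    using L unfolding C2_on_def by blast
  then have L': "(L has_derivative L' (X 0, V 0, t)) (at (X 0, V 0, t) within ?S)"
    using t by auto
  let ?D = "blinfun_apply (L' (X 0, V 0, t))"
  have chain: "((L \<circ> c) has_derivative (?D \<circ> c')) (at x)"
    if "(c has_derivative c') (at x)" "c x = (X 0, V 0, t)" "range c \<subseteq> ?S"
    for c c' and x :: "'c::real_normed_vector"
    using diff_chain_within[OF that(1)] has_derivative_subset[OF L' that(3)] that(2) by simp
  have "((L \<circ> (\<lambda>x. (x, V 0, t))) has_derivative (?D \<circ> (\<lambda>k. (k, 0, 0)))) (at (X 0))"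
    by (rule chain, intro has_derivative_Pair has_derivative_ident has_derivative_const) (use t in auto)
  then have gx: "gradient (\<lambda>x. L (x, V 0, t)) (X 0) \<bullet> X' = ?D (X', 0, 0)"
    using gradient_inner[of "\<lambda>x. L (x, V 0, t)"] by (fastforce simp: o_def)
  have "((L \<circ> (\<lambda>v. (X 0, v, t))) has_derivative (?D \<circ> (\<lambda>k. (0, k, 0)))) (at (V 0))"
    by (rule chain, intro has_derivative_Pair has_derivative_ident has_derivative_const) (use t in auto)
  then have gv: "gradient (\<lambda>v. L (X 0, v, t)) (V 0) \<bullet> V' = ?D (0, V', 0)"
    using gradient_inner[of "\<lambda>v. L (X 0, v, t)"] by (fastforce simp: o_def)
  have "((\<lambda>s. (X s, V s, t)) has_vector_derivative (X', V', 0)) (at 0)"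
    by (intro has_vector_derivative_Pair X V has_vector_derivative_const)
  moreover have "range (\<lambda>s. (X s, V s, t)) \<subseteq> ?S" using t by auto
  ultimately
  have "((\<lambda>s. L (X s, V s, t)) has_derivative (\<lambda>s. ?D (s *\<^sub>R (X', V', 0)))) (at 0)"
    using chain[of "\<lambda>s. (X s, V s, t)" _ 0] unfolding has_vector_derivative_def o_def by blast
  moreover have "(\<lambda>s. L (X s, V s, t)) = (\<lambda>_. L (X 0, V 0, t))"
    using const by blast
  ultimately have "((\<lambda>_. L (X 0, V 0, t)) has_derivative (\<lambda>s. ?D (s *\<^sub>R (X', V', 0)))) (at (0::real))"
    by (simp only:)
  from has_derivative_unique[OF this has_derivative_const]
  have "?D (s *\<^sub>R (X', V', 0)) = 0" for s :: real
    by (rule fun_cong)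
  then have "?D (1 *\<^sub>R (X', V', 0)) = 0" .
  moreover have "(X', V', 0::real) = (X', 0, 0) + (0, V', 0)" by simp
  ultimately show ?thesis
    unfolding gx gv by (simp only: blinfun.add_right scaleR_one)
qed

lemma right_frac_integral_near:
  assumes eq: "\<And>u. u \<in> {a<..b} \<Longrightarrow> g u = k u" and x: "x \<in> {a<..<b}"
  shows "right_frac_integral \<beta> b g x = right_frac_integral \<beta> b k x"
proof -
  have "integral {x..b} (\<lambda>y. (y - x) powr (\<beta> - 1) *\<^sub>R g y) =
      integral {x..b} (\<lambda>y. (y - x) powr (\<beta> - 1) *\<^sub>R k y)"
    by (rule integral_cong) (use eq x in auto)
  moreover have "g x = k x" using eq x by simp
  ultimately show ?thesis by (simp only: right_frac_integral_def)
qed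

text \<open>
  A right fractional derivative does not look to the left of \<open>t\<close>. This passes from \<open>\<partial>\<^sub>v L\<close>, given on
  \<open>{a<..b}\<close>, to its smooth extension \<open>g\<close> to \<open>{a..b}\<close>.
\<close>

lemma right_frac_deriv_transfer:
  fixes g k :: "real \<Rightarrow> 'b::euclidean_space"
  assumes eq: "\<And>u. u \<in> {a<..b} \<Longrightarrow> g u = k u" and t: "t \<in> {a<..<b}"
    and k: "right_frac_deriv_exists \<alpha> a b k t"
  shows "(right_frac_integral (1 - \<alpha>) b g has_vector_derivative - right_frac_deriv \<alpha> a b k t) (at t)"
proof -
  have at: "at t within {a..<b} = at t"
    by (rule at_within_nhd[of t "{a<..<b}"]) (use t in auto)
  have D: "(right_frac_integral (1 - \<alpha>) b k has_vector_derivative - right_frac_deriv \<alpha> a b k t) (at t)"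
    using k unfolding right_frac_deriv_exists_def right_frac_deriv_def at
    by (simp only: minus_minus vector_derivative_works)
  show ?thesis
    by (rule has_vector_derivative_transform_within_open[OF D, of "{a<..<b}"])
      (use t right_frac_integral_near[OF eq] in auto)
qed

text \<open>
  The \<open>s\<close>-derivative of the invariance at \<open>s = 0\<close>, with the term in \<open>x\<close> rewritten by the
  Euler-Lagrange equation.
\<close>

lemma fractional_noether_identity:
  fixes L :: "'b::euclidean_space \<times> 'b \<times> real \<Rightarrow> real"
  assumes \<alpha>: "\<alpha> \<le> 1" and t: "t \<in> {a<..<b}"
    and L: "C2_on (UNIV \<times> UNIV \<times> {a..b}) L"
    and grp: "one_parameter_group \<phi>"
    and inv: "frac_invariant \<alpha> a b L \<phi>"
    and sol: "fractional_EL_solution \<alpha> a b L q"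
    and f: "\<And>u. u \<in> {a..b} \<Longrightarrow> f u = vector_derivative (\<lambda>s. \<phi> s (q u)) (at 0)"
    and smooth: "smooth_curve_on {a..b} f"
  shows "left_frac_deriv \<alpha> a b f t \<bullet> dL_dv \<alpha> a b L q t =
    f t \<bullet> right_frac_deriv \<alpha> a b (dL_dv \<alpha> a b L q) t"
proof -
  have \<phi>: "C2_on UNIV (\<lambda>(s, x). \<phi> s x)" and \<phi>0: "\<phi> 0 = id"
    using grp by (auto simp: one_parameter_group_def)
  have q: "C2_on {a..b} q"
    and EL: "dL_dx \<alpha> a b L q t = - right_frac_deriv \<alpha> a b (dL_dv \<alpha> a b L q) t"
    using sol t by (auto simp: fractional_EL_solution_def eq_neg_iff_add_eq_0)
  note var = left_frac_deriv_group_variation[OF \<alpha> t \<phi> q f smooth]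
  have "L (\<phi> s (q t), left_frac_deriv \<alpha> a b (\<lambda>u. \<phi> s (q u)) t, t) =
      L (\<phi> 0 (q t), left_frac_deriv \<alpha> a b (\<lambda>u. \<phi> 0 (q u)) t, t)" for s
    using inv sol t unfolding frac_invariant_def by (simp add: \<phi>0)
  from stationary_along_curve[OF L _ var this] t
  have "dL_dx \<alpha> a b L q t \<bullet> f t + dL_dv \<alpha> a b L q t \<bullet> left_frac_deriv \<alpha> a b f t = 0"
    by (simp add: dL_dx_def dL_dv_def \<phi>0)
  then show ?thesis by (simp add: EL inner_commute)
qed

section \<open>The conserved quantity\<close>

theorem theorem6:
  fixes a b \<alpha> :: real
    and L :: "(real ^ 'd) \<times> (real ^ 'd) \<times> real \<Rightarrow> real"
    and \<phi> :: "real \<Rightarrow> real ^ 'd \<Rightarrow> real ^ 'd"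
    and q f g :: "real \<Rightarrow> real ^ 'd"
  assumes "a < b" and "0 < \<alpha>" and "\<alpha> \<le> 1"
    and "C2_on (UNIV \<times> UNIV \<times> {a..b}) L"
    and "one_parameter_group \<phi>"
    and "frac_invariant \<alpha> a b L \<phi>"
    and "fractional_EL_solution \<alpha> a b L q"
    and "\<forall>t\<in>{a..b}. f t = vector_derivative (\<lambda>s. \<phi> s (q t)) (at 0)"
    and "\<forall>t\<in>{a<..b}. g t = dL_dv \<alpha> a b L q t"
    and "smooth_curve_on {a..b} f"
    and "smooth_curve_on {a..b} g"
    and "uniform_limit {a..b}
           (\<lambda>p t. left_frac_integral (real (Suc p) - \<alpha>) a f t \<bullet> nth_deriv (Suc p) {a..b} g t)
           (\<lambda>_. 0) sequentially"
    and "uniform_limit {a..b}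
           (\<lambda>p t. nth_deriv (Suc p) {a..b} f t \<bullet> right_frac_integral (real (Suc p) - \<alpha>) b g t)
           (\<lambda>_. 0) sequentially"
  defines "bracket_term \<equiv> \<lambda>r t.
     (- 1) ^ r * (left_frac_integral (real r + 1 - \<alpha>) a f t \<bullet> nth_deriv r {a..b} g t)
     + nth_deriv r {a..b} f t \<bullet> right_frac_integral (real r + 1 - \<alpha>) b g t"
  shows "\<forall>t\<in>{a<..<b}. summable (\<lambda>r. bracket_term r t) \<and>
           ((\<lambda>t. \<Sum>r. bracket_term r t) has_real_derivative 0) (at t)"
proof
  fix t assume t: "t \<in> {a<..<b}"
  note \<alpha> = \<open>\<alpha> \<le> 1\<close> and f = \<open>smooth_curve_on {a..b} f\<close>
  let ?Dg = "right_frac_deriv \<alpha> a b (dL_dv \<alpha> a b L q) t"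
  have "(right_frac_integral (1 - \<alpha>) b g has_vector_derivative - ?Dg) (at t)"
    using right_frac_deriv_transfer[of a b g "dL_dv \<alpha> a b L q" t \<alpha>] assms(7,9) t
    by (auto simp: fractional_EL_solution_def)
  note transfer = transfer_formula[OF \<alpha> t assms(10-13) this]
  have "left_frac_deriv \<alpha> a b f t \<bullet> g t = f t \<bullet> ?Dg"
    using fractional_noether_identity[OF \<alpha> t assms(4-7) _ f] assms(8,9) t by auto
  then show "summable (\<lambda>r. bracket_term r t) \<and>
      ((\<lambda>t. \<Sum>r. bracket_term r t) has_real_derivative 0) (at t)"
    using transfer by (simp add: bracket_term_def)
qed

end
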